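(* Let $r\ge 1$ be an integer and let $p_1,\ldots,p_r$ be distinct primes, each of which is congruent to $1$ or $-1$ modulo $5$. Let $b=p_1\cdots p_r$. Then $$\left|\left\{c\in\mathbb{Z}: 1\le c\le b-1,\ \gcd(c,b)=1,\ S(c,b)=\frac{3}{b}-3\right\}\right|=2^r.$$
   Context: For a natural number $b$ (positive integer) and an integer $c$ with $\gcd(c,b)=1$, the classical Dedekind sum is $s(c,b)=\sum_{k=1}^{b}((k/b))((ck/b))$, where $((x))=x-\lfloor x\rfloor-1/2$ if $x\in\mathbb{R}\setminus\mathbb{Z}$ and $((x))=0$ if $x\in\mathbb{Z}$. The normalized Dedekind sum is $S(c,b)=12\,s(c,b)$. *)

theory Defs
  imports Complex_Main "HOL-Number_Theory.Number_Theory"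
begin

definition sawtooth :: "real \<Rightarrow> real" where
  "sawtooth x = (if x \<in> \<int> then 0 else x - of_int \<lfloor>x\<rfloor> - 1 / 2)"

(* Total in both arguments; the classical Dedekind sum is the case b > 0 and gcd c b = 1. *)
definition dedekind_sum :: "int \<Rightarrow> nat \<Rightarrow> real" where
  "dedekind_sum c b =
     (\<Sum>k = 1..b. sawtooth (real k / real b) * sawtooth (of_int c * real k / real b))"

definition normalized_dedekind_sum :: "int \<Rightarrow> nat \<Rightarrow> real" where
  "normalized_dedekind_sum c b = 12 * dedekind_sum c b"

end

theory Submission
  imports Defs
begin

text \<open>The condition \<open>S(c, b) = 3/b - 3\<close> is equivalent to \<open>b dvd c\<^sup>2 - 3 c + 1\<close>, a quadratic congruence of
  discriminant 5, which has two roots modulo each \<open>p\<close> by quadratic reciprocity and hence \<open>2 ^ r\<close>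
  modulo \<open>b\<close>. One direction is the congruence \<open>12 c D \<equiv> b (c\<^sup>2 + 1)\<close> modulo \<open>b\<^sup>2\<close> for the integer
  \<open>D = (\<Sum>k<b. k (c k mod b))\<close>. Conversely, reduce a root to \<open>0 < c < b\<close> and write
  \<open>c\<^sup>2 - 3 c + 1 = b q\<close>. Then \<open>q < c\<close> and \<open>q\<close> is the inverse of \<open>b\<close> modulo \<open>c\<close>, so \<open>S(b, c) = S(q, c)\<close>,
  and two applications of the reciprocity law relate \<open>S(c, b)\<close> to \<open>S(c, q)\<close>, where \<open>c\<close> is a root modulo
  the smaller \<open>q\<close>.\<close>

text \<open>The sum \<open>S(c, b)\<close> without its denominators: for coprime arguments
  \<open>b\<^sup>2 S = 12 D - 3 b\<^sup>2 (b - 1)\<close>. Starting at \<open>k = 0\<close> makes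
  the range a full residue system, so units permute it.\<close>

definition dsum :: "int \<Rightarrow> int \<Rightarrow> int" where
  "dsum c b = (\<Sum>k\<in>{0..<b}. k * (c * k mod b))"

section \<open>Elementary sums and permutations of residues\<close>

lemma sum_int_atLeast0LessThan:
  fixes n :: int
  assumes "n \<ge> 0"
  shows "2 * (\<Sum>k\<in>{0..<n}. k) = n * (n - 1)"
  using assms
proof (induction n rule: int_ge_induct)
  case (step i)
  have "{0..<i + 1} = insert i {0..<i}" using step by auto
  then show ?case using step by (simp add: algebra_simps)
qed simp

lemma sum_squares_int_atLeast0LessThan:
  fixes n :: int
  assumes "n \<ge> 0"
  shows "6 * (\<Sum>k\<in>{0..<n}. k\<^sup>2) = n * (n - 1) * (2 * n - 1)"
  using assms
proof (induction n rule: int_ge_induct)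
  case (step i)
  have "{0..<i + 1} = insert i {0..<i}" using step by auto
  then show ?case using step by (simp add: algebra_simps power2_eq_square)
qed simp

lemma zdiv_less_iff:
  fixes a d n :: int
  assumes "d > 0"
  shows "a div d < n \<longleftrightarrow> a < n * d"
proof -
  have "(a + (- n) * d) div d = a div d - n"
    using assms by (subst div_mult_self1) auto
  then show ?thesis using pos_imp_zdiv_neg_iff[OF assms, of "a + (- n) * d"] by simp
qed

lemma bij_betw_mult_mod:
  fixes b c :: int
  assumes "b > 0" "coprime c b"
  shows "bij_betw (\<lambda>k. c * k mod b) {0..<b} {0..<b}"
proof -
  have "inj_on (\<lambda>k. c * k mod b) {0..<b}"
  proof (rule inj_onI)
    fix x y assume xy: "x \<in> {0..<b}" "y \<in> {0..<b}" "c * x mod b = c * y mod b"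
    then have "[c * x = c * y] (mod b)" by (simp add: cong_def)
    then have "[x = y] (mod b)" using assms by (simp add: cong_mult_lcancel)
    then show "x = y" using xy by (simp add: cong_def)
  qed
  moreover have "(\<lambda>k. c * k mod b) ` {0..<b} \<subseteq> {0..<b}" using assms by auto
  ultimately show ?thesis
    unfolding bij_betw_def by (simp add: endo_inj_surj)
qed

text \<open>Substituting \<open>k = q * j\<close> permutes the residues and, since
  \<open>a * q * j\<close> reduces to \<open>j\<close>, swaps the two factors of each term.\<close>

lemma dsum_inverse:
  fixes a q c :: int
  assumes "c > 0" "[a * q = 1] (mod c)"
  shows "dsum a c = dsum q c"
proof -
  have cop: "coprime q c"
    using assms(2) by (metis coprime_iff_invertible_int mult.commute)
  have "dsum a c = (\<Sum>j\<in>{0..<c}. (q * j mod c) * (a * (q * j mod c) mod c))"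
    unfolding dsum_def
    by (rule sum.reindex_bij_betw[OF bij_betw_mult_mod[OF assms(1) cop], symmetric])
  also have "\<dots> = (\<Sum>j\<in>{0..<c}. j * (q * j mod c))"
  proof (rule sum.cong)
    fix j assume j: "j \<in> {0..<c}"
    have "[a * q * j = 1 * j] (mod c)" using assms(2) by (rule cong_scalar_right)
    then have "a * (q * j mod c) mod c = j"
      using j by (simp add: cong_def mod_mult_right_eq mult.assoc)
    then show "(q * j mod c) * (a * (q * j mod c) mod c) = j * (q * j mod c)" by simp
  qed simp
  finally show ?thesis by (simp add: dsum_def)
qed

section \<open>Quotient sums of a coprime pair and the reciprocity law\<close>

context
  fixes b c :: int
  assumes b: "b > 0" and cop: "coprime c b"
begin

lemma mod_eq_diff_div: "c * k mod b = c * k - b * (c * k div b)"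
  by (simp add: minus_mult_div_eq_mod)

lemma dsum_conv_div:
  "dsum c b = c * (\<Sum>k\<in>{0..<b}. k\<^sup>2) - b * (\<Sum>k\<in>{0..<b}. k * (c * k div b))"
  unfolding dsum_def mod_eq_diff_div
  by (simp add: sum_subtractf sum_distrib_left algebra_simps power2_eq_square)

lemma sum_div: "2 * (\<Sum>k\<in>{0..<b}. c * k div b) = (c - 1) * (b - 1)"
proof -
  have "(\<Sum>k\<in>{0..<b}. k) = (\<Sum>k\<in>{0..<b}. c * k mod b)"
    by (rule sum.reindex_bij_betw[OF bij_betw_mult_mod[OF b cop], symmetric])
  also have "\<dots> = c * (\<Sum>k\<in>{0..<b}. k) - b * (\<Sum>k\<in>{0..<b}. c * k div b)"
    unfolding mod_eq_diff_div by (simp add: sum_subtractf sum_distrib_left)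
  finally have "b * (2 * (\<Sum>k\<in>{0..<b}. c * k div b)) = (c - 1) * (2 * (\<Sum>k\<in>{0..<b}. k))"
    by (simp add: algebra_simps)
  also have "\<dots> = b * ((c - 1) * (b - 1))"
    using b by (simp add: sum_int_atLeast0LessThan)
  finally show ?thesis using b by simp
qed

text \<open>The residues \<open>c * k mod b\<close> permute the range, so their squares have the
  same sum. This ties the mixed sum to the sum of squared quotients, neither of which has a closed
  form here.\<close>

lemma sum_square_mod:
  "(\<Sum>k\<in>{0..<b}. k\<^sup>2) = c\<^sup>2 * (\<Sum>k\<in>{0..<b}. k\<^sup>2)
     - 2 * b * c * (\<Sum>k\<in>{0..<b}. k * (c * k div b)) + b\<^sup>2 * (\<Sum>k\<in>{0..<b}. (c * k div b)\<^sup>2)"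
proof -
  have "(\<Sum>k\<in>{0..<b}. k\<^sup>2) = (\<Sum>k\<in>{0..<b}. (c * k mod b)\<^sup>2)"
    by (rule sum.reindex_bij_betw[OF bij_betw_mult_mod[OF b cop], symmetric])
  also have "\<dots> = (\<Sum>k\<in>{0..<b}. c\<^sup>2 * k\<^sup>2 - 2 * b * c * (k * (c * k div b)) + b\<^sup>2 * (c * k div b)\<^sup>2)"
    unfolding mod_eq_diff_div by (rule sum.cong) (auto simp: power2_eq_square algebra_simps)
  also have "\<dots> = c\<^sup>2 * (\<Sum>k\<in>{0..<b}. k\<^sup>2)
     - 2 * b * c * (\<Sum>k\<in>{0..<b}. k * (c * k div b)) + b\<^sup>2 * (\<Sum>k\<in>{0..<b}. (c * k div b)\<^sup>2)"
    by (simp add: sum_subtractf sum.distrib sum_distrib_left)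
  finally show ?thesis .
qed

text \<open>Eliminating the mixed sum leaves the squared quotients with coefficient
  \<open>- 6 * b\<^sup>2\<close>, invisible modulo \<open>b\<^sup>2\<close>; only the sum of squares
  survives.\<close>

lemma dsum_cong_mod_square: "[12 * c * dsum c b = b * (c\<^sup>2 + 1)] (mod b\<^sup>2)"
proof -
  define Q F F2 where "Q = (\<Sum>k\<in>{0..<b}. k\<^sup>2)" and "F = (\<Sum>k\<in>{0..<b}. k * (c * k div b))"
    and "F2 = (\<Sum>k\<in>{0..<b}. (c * k div b)\<^sup>2)"
  have "dsum c b = c * Q - b * F" and *: "Q = c\<^sup>2 * Q - 2 * b * c * F + b\<^sup>2 * F2"
    using dsum_conv_div sum_square_mod by (simp_all add: Q_def F_def F2_def)
  moreover have "6 * Q = b * (b - 1) * (2 * b - 1)"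
    using b by (simp add: Q_def sum_squares_int_atLeast0LessThan)
  moreover have F: "2 * b * c * F = c\<^sup>2 * Q + b\<^sup>2 * F2 - Q" using * by linarith
  moreover have "12 * c * (c * Q - b * F) = 12 * c\<^sup>2 * Q - 6 * (2 * b * c * F)"
    by (simp add: algebra_simps power2_eq_square)
  then have "12 * c * (c * Q - b * F) = (c\<^sup>2 + 1) * (6 * Q) - 6 * (b\<^sup>2 * F2)"
    unfolding F by (simp add: algebra_simps)
  ultimately have "12 * c * dsum c b = (c\<^sup>2 + 1) * (6 * Q) - 6 * (b\<^sup>2 * F2)"
    by (simp only:)
  \<comment> \<open>The factor \<open>2 * b - 3\<close> comes from
    \<open>(b - 1) * (2 * b - 1) = 1 + b * (2 * b - 3)\<close>.\<close>
  then have "12 * c * dsum c b - b * (c\<^sup>2 + 1) = b\<^sup>2 * ((c\<^sup>2 + 1) * (2 * b - 3) - 6 * F2)"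
    unfolding \<open>6 * Q = _\<close> by (simp add: algebra_simps power2_eq_square)
  then show ?thesis by (simp add: cong_iff_dvd_diff)
qed

text \<open>Both sides count lattice points \<open>(k, j)\<close> below the diagonal of the \<open>b \<times> c\<close> rectangle,
  weighted by \<open>2 * j\<close>.\<close>

lemma sum_div_lattice:
  assumes c: "c > 0"
  shows "(\<Sum>k\<in>{0..<b}. (c * k div b) * (c * k div b + 1))
       = (\<Sum>j\<in>{0..<c}. 2 * j * (b - 1 - b * j div c))"
proof -
  \<comment> \<open>With \<open>f = c * k div b\<close>, the product \<open>f * (f + 1)\<close> is
    the sum of \<open>2 * j\<close> over \<open>j \<le> f\<close>, that is, over
    \<open>j * b \<le> c * k\<close>.\<close>
  have "(\<Sum>k\<in>{0..<b}. (c * k div b) * (c * k div b + 1))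
      = (\<Sum>k\<in>{0..<b}. \<Sum>j | j \<in> {0..<c} \<and> j * b \<le> c * k. 2 * j)"
  proof (rule sum.cong)
    fix k assume k: "k \<in> {0..<b}"
    define f where "f = c * k div b"
    have "f \<ge> 0" using k b c by (simp add: f_def pos_imp_zdiv_nonneg_iff)
    have "c * k < c * b" using k c by simp
    then have "f < c" using b by (simp add: f_def zdiv_less_iff)
    have le: "j * b \<le> c * k \<longleftrightarrow> j \<le> f" for j
      using b by (simp add: f_def zdiv_less_iff not_less[symmetric])
    have "{j. j \<in> {0..<c} \<and> j * b \<le> c * k} = {0..<f + 1}"
      using \<open>f < c\<close> by (auto simp: le)
    then show "(c * k div b) * (c * k div b + 1) = (\<Sum>j | j \<in> {0..<c} \<and> j * b \<le> c * k. 2 * j)"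
      using sum_int_atLeast0LessThan[of "f + 1"] \<open>f \<ge> 0\<close>
      by (simp add: f_def[symmetric] sum_distrib_left mult.commute[of f])
  qed simp
  also have "\<dots> = (\<Sum>j\<in>{0..<c}. \<Sum>k | k \<in> {0..<b} \<and> j * b \<le> c * k. 2 * j)"
    by (rule sum.swap_restrict) auto
  also have "\<dots> = (\<Sum>j\<in>{0..<c}. 2 * j * (b - 1 - b * j div c))"
  proof (rule sum.cong)
    fix j assume j: "j \<in> {0..<c}"
    show "(\<Sum>k | k \<in> {0..<b} \<and> j * b \<le> c * k. 2 * j) = 2 * j * (b - 1 - b * j div c)"
    \<comment> \<open>At \<open>j = 0\<close> all \<open>b\<close> values of \<open>k\<close>
      qualify, one more than the formula counts; the weight 0 hides this.\<close>
    proof (cases "j = 0")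
      case False
      define g where "g = b * j div c"
      have "g \<ge> 0" using j b c by (simp add: g_def pos_imp_zdiv_nonneg_iff)
      have "b * j < b * c" using j b by simp
      then have "g < b" using c by (simp add: g_def zdiv_less_iff)
      \<comment> \<open>Coprimality keeps lattice points with \<open>j > 0\<close> off the diagonal,
        so the weak inequality becomes strict.\<close>
      have "\<not> c dvd b * j"
        using cop j False by (auto simp: coprime_dvd_mult_right_iff dest: zdvd_imp_le)
      have le: "j * b \<le> c * k \<longleftrightarrow> g < k" for k
      proof -
        have "c * k \<noteq> b * j" using \<open>\<not> c dvd b * j\<close> by (metis dvd_triv_left)
        then have "j * b \<le> c * k \<longleftrightarrow> b * j < k * c" by (auto simp: mult.commute)
        then show ?thesis using c by (simp add: g_def zdiv_less_iff)
      qed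
      have "{k. k \<in> {0..<b} \<and> j * b \<le> c * k} = {g + 1..<b}"
        unfolding le using \<open>g \<ge> 0\<close> by auto
      then show ?thesis using \<open>g < b\<close> by (simp add: g_def[symmetric])
    qed simp
  qed simp
  finally show ?thesis .
qed

end

text \<open>This is \<open>S(c, b) + S(b, c) = b/c + c/b + 1/(b c) - 3\<close> multiplied by
  \<open>b\<^sup>2 c\<^sup>2\<close>. The square sums eliminate \<open>F1\<close>, the lattice count
  eliminates \<open>G1\<close>, and the two contributions of \<open>F2\<close> cancel;
  \<open>Q\<close>, \<open>R\<close> and \<open>F\<close> have closed forms.\<close>

theorem dsum_reciprocity:
  fixes b c :: int
  assumes b: "b > 0" and c: "c > 0" and cop: "coprime c b"
  shows "12 * c\<^sup>2 * dsum c b + 12 * b\<^sup>2 * dsum b c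
       = b\<^sup>2 * c\<^sup>2 * (3 * b + 3 * c - 9) + b ^ 3 * c + c ^ 3 * b + b * c"
proof -
  define Q R F1 F2 F G1 where "Q = (\<Sum>k\<in>{0..<b}. k\<^sup>2)" and "R = (\<Sum>k\<in>{0..<c}. k\<^sup>2)"
    and "F1 = (\<Sum>k\<in>{0..<b}. k * (c * k div b))"
    and "F2 = (\<Sum>k\<in>{0..<b}. (c * k div b)\<^sup>2)" and "F = (\<Sum>k\<in>{0..<b}. c * k div b)"
    and "G1 = (\<Sum>j\<in>{0..<c}. j * (b * j div c))"
  note defs = this
  have 1: "dsum c b = c * Q - b * F1"
    using dsum_conv_div[OF b cop] by (simp add: defs)
  have 2: "dsum b c = b * R - c * G1"
    using dsum_conv_div[OF c, of b] cop by (simp add: defs coprime_commute)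
  have 3: "6 * Q = b * (b - 1) * (2 * b - 1)" "6 * R = c * (c - 1) * (2 * c - 1)"
    using b c by (simp_all add: defs sum_squares_int_atLeast0LessThan)
  have 4: "2 * F = (c - 1) * (b - 1)" using sum_div[OF b cop] by (simp add: defs)
  have 5: "Q = c\<^sup>2 * Q - 2 * b * c * F1 + b\<^sup>2 * F2"
    using sum_square_mod[OF b cop] by (simp add: defs)
  have "F2 + F = (\<Sum>k\<in>{0..<b}. (c * k div b) * (c * k div b + 1))"
    by (simp add: defs sum.distrib algebra_simps power2_eq_square)
  also have "\<dots> = (\<Sum>j\<in>{0..<c}. 2 * j * (b - 1 - b * j div c))"
    by (rule sum_div_lattice[OF b cop c])
  also have "\<dots> = (\<Sum>j\<in>{0..<c}. (b - 1) * (2 * j) - 2 * (j * (b * j div c)))"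
    by (rule sum.cong) (auto simp: algebra_simps)
  also have "\<dots> = (b - 1) * (2 * (\<Sum>j\<in>{0..<c}. j)) - 2 * G1"
    by (simp add: defs sum_subtractf sum_distrib_left)
  also have "\<dots> = (b - 1) * (c * (c - 1)) - 2 * G1"
    using c by (simp add: sum_int_atLeast0LessThan)
  finally have 6: "F2 + F = (b - 1) * (c * (c - 1)) - 2 * G1" .
  have F1: "2 * b * c * F1 = c\<^sup>2 * Q + b\<^sup>2 * F2 - Q"
    and G1: "2 * G1 = (b - 1) * (c * (c - 1)) - F2 - F"
    using 5 6 by linarith+
  have "12 * c\<^sup>2 * dsum c b + 12 * b\<^sup>2 * dsum b c
      = 12 * c ^ 3 * Q - 6 * c * (2 * b * c * F1) + 12 * b ^ 3 * R - 6 * b\<^sup>2 * c * (2 * G1)"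
    unfolding 1 2 by (simp add: algebra_simps power2_eq_square power3_eq_cube)
  also have "\<dots> = (c ^ 3 + c) * (6 * Q) + 2 * b ^ 3 * (6 * R)
      - 6 * b\<^sup>2 * c\<^sup>2 * (b - 1) * (c - 1) + 3 * b\<^sup>2 * c * (2 * F)"
    unfolding F1 G1 by (simp add: algebra_simps power2_eq_square power3_eq_cube)
  also have "\<dots> = b\<^sup>2 * c\<^sup>2 * (3 * b + 3 * c - 9) + b ^ 3 * c + c ^ 3 * b + b * c"
    unfolding 3 4 by (simp add: algebra_simps power2_eq_square power3_eq_cube)
  finally show ?thesis .
qed

section \<open>Evaluation at roots of the quadratic\<close>

lemma dsum_mod: "dsum (c mod b) b = dsum c b"
  by (simp add: dsum_def mod_mult_left_eq)

lemma coprime_root: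
  fixes b c :: int
  assumes "b dvd c\<^sup>2 - 3 * c + 1"
  shows "coprime c b"
proof (rule coprimeI)
  fix d assume d: "d dvd c" "d dvd b"
  then have "d dvd c\<^sup>2 - 3 * c + 1" using assms dvd_trans by blast
  moreover have "d dvd c * (c - 3)" using d by simp
  ultimately have "d dvd (c\<^sup>2 - 3 * c + 1) - c * (c - 3)" by (rule dvd_diff)
  then show "is_unit d" by (simp add: power2_eq_square algebra_simps)
qed

text \<open>The value is \<open>S(c, b) = 3/b - 3\<close> solved for \<open>D\<close>. Strong
  induction on the modulus: the descent passes from \<open>b\<close> to the cofactor
  \<open>q\<close> of the reduced root.\<close>

theorem dsum_root:
  fixes b c :: int
  assumes "b > 0" "b dvd c\<^sup>2 - 3 * c + 1"
  shows "4 * dsum c b = b * (b - 1)\<^sup>2"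
  using assms
proof (induction "nat b" arbitrary: b c rule: less_induct)
  case less
  define x where "x = c mod b"
  have "[x\<^sup>2 - 3 * x + 1 = c\<^sup>2 - 3 * c + 1] (mod b)"
    unfolding x_def by (intro cong_add cong_diff cong_mult cong_pow) (simp_all add: cong_def)
  then have dvd: "b dvd x\<^sup>2 - 3 * x + 1" using less.prems(2) cong_dvd_iff by blast
  have x: "0 \<le> x" "x < b" using less.prems(1) by (simp_all add: x_def)
  have ds: "dsum c b = dsum x b" by (simp add: x_def dsum_mod)
  show ?case
  proof (cases "b = 1")
    case True
    then show ?thesis by (simp add: dsum_def)
  next
    case False
    then have "b > 1" using less.prems(1) by simp
    \<comment> \<open>The quadratic takes the values 1, -1, -1 at 0, 1, 2. From 3 on it is positive,
      hence so is \<open>q\<close>.\<close>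
    have "x \<noteq> 0" "x \<noteq> 1" "x \<noteq> 2" using dvd \<open>b > 1\<close> by (auto simp: zdvd1_eq)
    then have x3: "x \<ge> 3" using x by simp
    obtain q where q: "x\<^sup>2 - 3 * x + 1 = b * q" using dvd by auto
    have "x * (x - 3) \<ge> 0" using x3 by simp
    then have bq: "b * q > 0" using q by (simp add: power2_eq_square algebra_simps)
    then have "q > 0" using less.prems(1) by (simp add: zero_less_mult_iff)
    have "b * q < b * x"
    proof -
      have "b * q < x * x" using q x3 by (simp add: power2_eq_square)
      also have "\<dots> \<le> b * x" using x by (simp add: mult_right_mono)
      finally show ?thesis .
    qed
    then have "q < x" using less.prems(1) by simp
    have "q dvd x\<^sup>2 - 3 * x + 1" using q by simp
    have IH: "4 * dsum x q = q * (q - 1)\<^sup>2"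
      using less.hyps[of q x] \<open>q > 0\<close> \<open>q < x\<close> x \<open>q dvd _\<close> by simp
    \<comment> \<open>Here \<open>b * q - 1 = x * (x - 3)\<close>.\<close>
    have "[b * q = 1] (mod x)"
      using q by (auto simp: cong_iff_dvd_diff power2_eq_square intro!: dvdI[of _ _ "x - 3"])
         (simp add: algebra_simps)
    then have inv: "dsum b x = dsum q x" using x3 by (intro dsum_inverse) auto
    have R1: "12 * x\<^sup>2 * dsum x b + 12 * b\<^sup>2 * dsum b x
       = b\<^sup>2 * x\<^sup>2 * (3 * b + 3 * x - 9) + b ^ 3 * x + x ^ 3 * b + b * x"
      using x3 less.prems(1) coprime_root[OF dvd] by (intro dsum_reciprocity) auto
    have R2: "12 * x\<^sup>2 * dsum x q + 12 * q\<^sup>2 * dsum q x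
       = q\<^sup>2 * x\<^sup>2 * (3 * q + 3 * x - 9) + q ^ 3 * x + x ^ 3 * q + q * x"
      using x3 \<open>q > 0\<close> coprime_root[OF \<open>q dvd _\<close>] by (intro dsum_reciprocity) auto
    \<comment> \<open>Weighting the two reciprocity laws by \<open>q\<^sup>2\<close> and
      \<open>b\<^sup>2\<close> cancels the equal sums modulo \<open>x\<close>.\<close>
    have "12 * x\<^sup>2 * q\<^sup>2 * dsum x b - 3 * x\<^sup>2 * b\<^sup>2 * (4 * dsum x q)
        = q\<^sup>2 * (12 * x\<^sup>2 * dsum x b + 12 * b\<^sup>2 * dsum b x)
          - b\<^sup>2 * (12 * x\<^sup>2 * dsum x q + 12 * q\<^sup>2 * dsum q x)"
      unfolding inv by (simp add: algebra_simps)
    also have "\<dots> = q * b * x * (b - q) * (3 * (b * q) * x + b * q - (x\<^sup>2 + 1))"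
      unfolding R1 R2 by (simp add: algebra_simps power2_eq_square power3_eq_cube)
    also have "3 * (b * q) * x + b * q - (x\<^sup>2 + 1) = 3 * x * (b * q - 1)"
      using q by (simp add: algebra_simps)
    \<comment> \<open>This rests on \<open>b * (q - 1)\<^sup>2 + (b - q) * (b * q - 1) = q * (b -
      1)\<^sup>2\<close>.\<close>
    finally have "3 * q\<^sup>2 * x\<^sup>2 * (4 * dsum x b) = 3 * q\<^sup>2 * x\<^sup>2 * (b * (b - 1)\<^sup>2)"
      unfolding IH by (simp add: algebra_simps power2_eq_square)
    then show ?thesis using \<open>q > 0\<close> x3 ds by simp
  qed
qed

section \<open>From the integer sum back to the Dedekind sum\<close>

lemma normalized_dedekind_sum_conv_dsum:
  assumes b: "b > 0" and cop: "coprime c (int b)"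
  shows "(real b)\<^sup>2 * normalized_dedekind_sum c b
       = 12 * of_int (dsum c (int b)) - 3 * (real b)\<^sup>2 * (real b - 1)"
proof -
  define f where "f k = sawtooth (of_int k / real b) * sawtooth (of_int c * of_int k / real b)" for k :: int
  \<comment> \<open>The term \<open>k = b\<close> vanishes by the convention at integers, just as
    \<open>k = 0\<close> contributes nothing to \<open>dsum\<close>.\<close>
  have b0: "f (int b) = 0" by (simp add: f_def sawtooth_def)
  have "dedekind_sum c b = (\<Sum>k\<in>{1..b}. f (int k))"
    by (simp add: dedekind_sum_def f_def)
  also have "{1..b} = insert b {1..<b}" using b by auto
  also have "(\<Sum>k\<in>insert b {1..<b}. f (int k)) = (\<Sum>k\<in>{1..<b}. f (int k))"
    using b0 by simp
  also have "\<dots> = (\<Sum>k\<in>{1..<int b}. f k)"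
    by (rule sum.reindex_bij_witness[of _ nat int]) auto
  finally have D: "dedekind_sum c b = (\<Sum>k\<in>{1..<int b}. f k)" .
  \<comment> \<open>With \<open>m = c * k mod b\<close>, the right side is
    \<open>(2 * k - b) * (2 * m - b)\<close>: off the integers the sawtooth is the residue over
    \<open>b\<close>, minus 1/2.\<close>
  have f: "4 * (real b)\<^sup>2 * f k = of_int (4 * (k * (c * k mod int b)) - 2 * int b * k - 2 * int b * (c * k mod int b) + (int b)\<^sup>2)"
    if k: "k \<in> {1..<int b}" for k :: int
  proof -
    have saw: "sawtooth (of_int m / real b) = of_int (m mod int b) / real b - 1 / 2"
      if "\<not> int b dvd m" for m :: int
    proof -
      have "\<lfloor>of_int m / real b\<rfloor> = m div int b"
        by (metis floor_divide_of_int_eq of_int_of_nat_eq)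
      moreover have "of_int m / real b \<notin> \<int>"
      proof
        assume "of_int m / real b \<in> \<int>"
        then obtain z where "of_int m / real b = of_int z" by (auto elim: Ints_cases)
        then have "(of_int m :: real) = of_int (z * int b)" using b by (simp add: field_simps)
        then have "m = z * int b" by linarith
        then show False using that by simp
      qed
      moreover have "(of_int m :: real) = of_int (m div int b) * real b + of_int (m mod int b)"
        by (metis div_mult_mod_eq of_int_add of_int_mult of_int_of_nat_eq)
      ultimately show ?thesis using b by (simp add: sawtooth_def field_simps)
    qed
    have "\<not> int b dvd k" using k by (auto dest: zdvd_imp_le)
    moreover have "\<not> int b dvd c * k"
      using \<open>\<not> int b dvd k\<close> cop by (metis coprime_commute coprime_dvd_mult_right_iff)
    ultimately have "f k = (of_int k / real b - 1 / 2) * (of_int (c * k mod int b) / real b - 1 / 2)"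
      using saw[of k] saw[of "c * k"] k by (simp add: f_def)
    then show ?thesis using b by (simp add: field_simps power2_eq_square)
  qed
  define A M where "A = (\<Sum>k\<in>{1..<int b}. k)" and "M = (\<Sum>k\<in>{1..<int b}. c * k mod int b)"
  have split: "{0..<int b} = insert 0 {1..<int b}" using b by auto
  have A: "A = (\<Sum>k\<in>{0..<int b}. k)" by (simp add: split A_def)
  have M: "M = (\<Sum>k\<in>{0..<int b}. c * k mod int b)" by (simp add: split M_def)
  have "M = A" unfolding A M
    by (rule sum.reindex_bij_betw[OF bij_betw_mult_mod]) (use assms in auto)
  have A2: "2 * A = int b * (int b - 1)" unfolding A by (simp add: sum_int_atLeast0LessThan)
  have ds: "dsum c (int b) = (\<Sum>k\<in>{1..<int b}. k * (c * k mod int b))"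
    by (simp add: dsum_def split)
  have "4 * (real b)\<^sup>2 * dedekind_sum c b = (\<Sum>k\<in>{1..<int b}. 4 * (real b)\<^sup>2 * f k)"
    by (simp add: D sum_distrib_left)
  also have "\<dots> = of_int (\<Sum>k\<in>{1..<int b}. 4 * (k * (c * k mod int b)) - 2 * int b * k - 2 * int b * (c * k mod int b) + (int b)\<^sup>2)"
    unfolding of_int_sum by (rule sum.cong) (use f in auto)
  also have "(\<Sum>k\<in>{1..<int b}. 4 * (k * (c * k mod int b)) - 2 * int b * k - 2 * int b * (c * k mod int b) + (int b)\<^sup>2)
      = 4 * dsum c (int b) - 2 * int b * A - 2 * int b * M + (int b - 1) * (int b)\<^sup>2"
    using b by (simp add: sum.distrib sum_subtractf ds A_def M_def sum_distrib_left)
  also have "\<dots> = 4 * dsum c (int b) - (int b - 1) * (int b)\<^sup>2"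
  proof -
    have "2 * int b * A = int b * (int b * (int b - 1))" using A2 by (simp add: mult.assoc)
    then show ?thesis unfolding \<open>M = A\<close> by (simp add: algebra_simps power2_eq_square)
  qed
  finally show ?thesis
    by (simp add: normalized_dedekind_sum_def algebra_simps)
qed

text \<open>The equation says \<open>4 * D = b * (b - 1)\<^sup>2\<close>, which
  \<open>dsum_root\<close> gives at roots. Conversely, inserting this value into the congruence
  modulo \<open>b\<^sup>2\<close> lets one factor \<open>b\<close> cancel and leaves the quadratic
  divisible by \<open>b\<close>.\<close>

theorem normalized_dedekind_sum_eq_iff_root:
  assumes b: "b > 0" and cop: "coprime c (int b)"
  shows "normalized_dedekind_sum c b = 3 / real b - 3 \<longleftrightarrow> int b dvd c\<^sup>2 - 3 * c + 1"
proof -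
  have "normalized_dedekind_sum c b = 3 / real b - 3 \<longleftrightarrow>
     (real b)\<^sup>2 * normalized_dedekind_sum c b = (real b)\<^sup>2 * (3 / real b - 3)"
    using b by simp
  also have "(real b)\<^sup>2 * (3 / real b - 3) = 3 * real b - 3 * (real b)\<^sup>2"
    using b by (simp add: field_simps power2_eq_square)
  also have "(real b)\<^sup>2 * normalized_dedekind_sum c b = 3 * real b - 3 * (real b)\<^sup>2 \<longleftrightarrow>
     real_of_int (4 * dsum c (int b)) = of_int (int b * (int b - 1)\<^sup>2)"
    unfolding normalized_dedekind_sum_conv_dsum[OF assms]
    by (simp add: power2_eq_square algebra_simps) linarith
  also have "\<dots> \<longleftrightarrow> 4 * dsum c (int b) = int b * (int b - 1)\<^sup>2"
    by (rule of_int_eq_iff)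
  also have "\<dots> \<longleftrightarrow> int b dvd c\<^sup>2 - 3 * c + 1"
  proof
    assume *: "4 * dsum c (int b) = int b * (int b - 1)\<^sup>2"
    have "(int b)\<^sup>2 dvd b * (c\<^sup>2 + 1) - 12 * c * dsum c (int b)"
      using dsum_cong_mod_square[of "int b" c] assms by (simp add: cong_iff_dvd_diff dvd_diff_commute)
    also have "b * (c\<^sup>2 + 1) - 12 * c * dsum c (int b)
        = int b * ((c\<^sup>2 - 3 * c + 1) - int b * (3 * c * (int b - 2)))"
    proof -
      have "12 * c * dsum c (int b) = 3 * c * (int b * (int b - 1)\<^sup>2)"
        unfolding *[symmetric] by simp
      then show ?thesis by (simp add: algebra_simps power2_eq_square)
    qed
    finally have "int b dvd (c\<^sup>2 - 3 * c + 1) - int b * (3 * c * (int b - 2))"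
      using b by (simp add: power2_eq_square)
    then show "int b dvd c\<^sup>2 - 3 * c + 1"
      by (simp add: dvd_diff_left_iff)
  qed (use b dsum_root in auto)
  finally show ?thesis .
qed

section \<open>Counting the roots modulo a prime and modulo \<open>b\<close>\<close>

lemma card_roots_mod_prime:
  fixes p :: nat
  assumes p: "prime p" and p5: "[int p = 1] (mod 5) \<or> [int p = - 1] (mod 5)"
  shows "card {x \<in> {0..<int p}. int p dvd x\<^sup>2 - 3 * x + 1} = 2"
proof -
  have "p \<noteq> 2" "p \<noteq> 5" using p5 by (auto simp: cong_def)
  then have p2: "p > 2" using prime_ge_2_nat[OF p] by simp
  have ip: "prime (int p)" using p by simp
  have "\<not> int p dvd 5"
    using primes_dvd_imp_eq[OF p, of 5] \<open>p \<noteq> 5\<close> by (auto simp: int_dvd_int_iff[of p 5, simplified])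
  \<comment> \<open>This says that \<open>p\<close> is a square modulo 5: the residues 1 and -1 are
    the squares of 1 and 2.\<close>
  have "QuadRes 5 (int p)"
    using p5
  proof
    assume "[int p = 1] (mod 5)"
    then have "[1\<^sup>2 = int p] (mod 5)" by (simp add: cong_sym_eq)
    then show ?thesis unfolding QuadRes_def by blast
  next
    assume "[int p = - 1] (mod 5)"
    then have "[2\<^sup>2 = int p] (mod 5)" by (simp add: cong_def)
    then show ?thesis unfolding QuadRes_def by blast
  qed
  moreover have "\<not> [int p = 0] (mod 5)" using p5 by (auto simp: cong_def)
  ultimately have "Legendre (int p) (int 5) = 1" by (simp add: Legendre_def)
  \<comment> \<open>As \<open>(5 - 1) div 2\<close> is even, the sign is 1 and 5 is a square modulo
    \<open>p\<close>.\<close>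
  moreover have "Legendre (int p) (int 5) * Legendre (int 5) (int p) = (- 1) ^ ((p - 1) div 2 * ((5 - 1) div 2))"
    using p p2 \<open>p \<noteq> 5\<close> by (intro Quadratic_Reciprocity) auto
  ultimately have "Legendre 5 (int p) = 1" by (simp add: power_mult[symmetric])
  then obtain y where y: "[y\<^sup>2 = 5] (mod int p)"
    by (auto simp: Legendre_def QuadRes_def split: if_splits)
  have "coprime 2 (int p)"
    using p p2 by (simp add: prime_odd_nat)
  then obtain h where h: "[2 * h = 1] (mod int p)" using cong_solve_coprime_int by blast
  \<comment> \<open>The quadratic formula \<open>(3 + y) / 2\<close>, with \<open>h\<close>
    inverting 2 and \<open>y\<close> a square root of the discriminant 5.\<close>
  define u where "u = h * (y + 3) mod int p"
  have "[2 * u = 2 * h * (y + 3)] (mod int p)"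
    by (simp add: u_def cong_def mod_mult_right_eq mult.assoc)
  also have "[2 * h * (y + 3) = 1 * (y + 3)] (mod int p)" using h by (rule cong_scalar_right)
  finally have "int p dvd 2 * u - 3 - y" by (simp add: cong_iff_dvd_diff algebra_simps)
  then have uy: "[2 * u - 3 = y] (mod int p)" by (simp add: cong_iff_dvd_diff)
  then have "[(2 * u - 3)\<^sup>2 = y\<^sup>2] (mod int p)" by (rule cong_pow)
  then have u5: "[(2 * u - 3)\<^sup>2 = 5] (mod int p)" using y by (rule cong_trans)
  then have "int p dvd 2 * (2 * (u\<^sup>2 - 3 * u + 1))"
    by (simp add: cong_iff_dvd_diff algebra_simps power2_eq_square)
  moreover have "coprime (int p) 2" using \<open>coprime 2 (int p)\<close> by (simp only: coprime_commute)
  ultimately have root: "int p dvd u\<^sup>2 - 3 * u + 1"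
    by (simp only: coprime_dvd_mult_right_iff)
  \<comment> \<open>The second root, since the roots add up to 3.\<close>
  define v where "v = (3 - u) mod int p"
  have factor: "int p dvd x\<^sup>2 - 3 * x + 1 \<longleftrightarrow> [x = u] (mod int p) \<or> [x = 3 - u] (mod int p)" for x
  proof -
    have "x\<^sup>2 - 3 * x + 1 = (x - u) * (x - (3 - u)) + (u\<^sup>2 - 3 * u + 1)"
      by (simp add: algebra_simps power2_eq_square)
    then have "int p dvd x\<^sup>2 - 3 * x + 1 \<longleftrightarrow> int p dvd (x - u) * (x - (3 - u))"
      using root by (simp only: dvd_add_left_iff)
    then show ?thesis using ip by (simp add: prime_dvd_mult_iff cong_iff_dvd_diff)
  qed
  have range: "u \<in> {0..<int p}" "v \<in> {0..<int p}" using p2 by (simp_all add: u_def v_def)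
  have "{x \<in> {0..<int p}. int p dvd x\<^sup>2 - 3 * x + 1} = {u, v}"
  proof -
    have "x = u \<longleftrightarrow> [x = u] (mod int p)" "x = v \<longleftrightarrow> [x = 3 - u] (mod int p)"
      if "x \<in> {0..<int p}" for x
      using that range by (auto simp: cong_def v_def)
    then show ?thesis using range by (auto simp: factor)
  qed
  \<comment> \<open>A double root would make \<open>2 * u - 3\<close>, a square root of 5, vanish
    modulo \<open>p\<close>, forcing \<open>p\<close> to divide 5.\<close>
  moreover have "u \<noteq> v"
  proof
    assume "u = v"
    then have "[u = 3 - u] (mod int p)" by (simp add: v_def cong_def) (metis mod_mod_trivial)
    then have "[2 * u - 3 = 0] (mod int p)" by (simp add: cong_iff_dvd_diff)
    then have "[(2 * u - 3)\<^sup>2 = 0\<^sup>2] (mod int p)" by (rule cong_pow)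
    then have "[5 = 0] (mod int p)" using u5 by (metis cong_sym cong_trans zero_power2)
    then show False using \<open>\<not> int p dvd 5\<close> by (simp add: cong_0_iff)
  qed
  ultimately show ?thesis by simp
qed

text \<open>Chinese remaindering of root sets. The hypothesis on \<open>f\<close>, shared by all
  integer polynomials, makes being a root modulo \<open>k\<close> depend only on the
  residue.\<close>

lemma card_roots_mod_mult:
  fixes m n :: int and f :: "int \<Rightarrow> int"
  assumes "m > 0" "n > 0" and cop: "coprime m n"
    and f: "\<And>k x y. [x = y] (mod k) \<Longrightarrow> [f x = f y] (mod k)"
  shows "card {x \<in> {0..<m * n}. m * n dvd f x}
       = card {x \<in> {0..<m}. m dvd f x} * card {x \<in> {0..<n}. n dvd f x}"
proof -
  let ?R = "\<lambda>k. {x \<in> {0..<k}. k dvd f x}"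
  have mod: "k dvd f (x mod k) \<longleftrightarrow> k dvd f x" for k x
    using f[of "x mod k" x k] cong_dvd_iff by (simp add: cong_dvd_iff)
  have "bij_betw (\<lambda>x. (x mod m, x mod n)) (?R (m * n)) (?R m \<times> ?R n)"
    unfolding bij_betw_def
  proof
    show "inj_on (\<lambda>x. (x mod m, x mod n)) (?R (m * n))"
    proof (rule inj_onI)
      fix x y assume xy: "x \<in> ?R (m * n)" "y \<in> ?R (m * n)" "(x mod m, x mod n) = (y mod m, y mod n)"
      then have "[x = y] (mod m * n)"
        using cop by (intro coprime_cong_mult) (auto simp: cong_def)
      then show "x = y" using xy by (simp add: cong_def)
    qed
    show "(\<lambda>x. (x mod m, x mod n)) ` ?R (m * n) = ?R m \<times> ?R n"
    proof
      show "(\<lambda>x. (x mod m, x mod n)) ` ?R (m * n) \<subseteq> ?R m \<times> ?R n"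
        using assms(1,2) by (auto simp: mod dest: dvd_mult_left dvd_mult_right)
      show "?R m \<times> ?R n \<subseteq> (\<lambda>x. (x mod m, x mod n)) ` ?R (m * n)"
      proof clarify
        fix a b assume a: "a \<in> {0..<m}" "m dvd f a" and b: "b \<in> {0..<n}" "n dvd f b"
        obtain z where z: "[z = a] (mod m)" "[z = b] (mod n)"
          using binary_chinese_remainder_int[OF cop] by blast
        define x where "x = z mod (m * n)"
        have x: "x mod m = a" "x mod n = b"
          using z a b by (auto simp: x_def cong_def mod_mod_cancel)
        then have "m dvd f x" "n dvd f x" using mod[of m x] mod[of n x] a b by auto
        then have "x \<in> ?R (m * n)"
          using cop assms(1,2) by (simp add: x_def divides_mult)
        then show "(a, b) \<in> (\<lambda>x. (x mod m, x mod n)) ` ?R (m * n)" using x by force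
      qed
    qed
  qed
  then show ?thesis by (simp add: bij_betw_same_card card_cartesian_product)
qed

lemma card_roots_mod_prod_primes:
  fixes p :: "'a \<Rightarrow> nat"
  assumes "finite I" "inj_on p I" "\<And>i. i \<in> I \<Longrightarrow> prime (p i)"
    and "\<And>i. i \<in> I \<Longrightarrow> [int (p i) = 1] (mod 5) \<or> [int (p i) = - 1] (mod 5)"
  shows "card {x \<in> {0..<int (\<Prod>i\<in>I. p i)}. int (\<Prod>i\<in>I. p i) dvd x\<^sup>2 - 3 * x + 1} = 2 ^ card I"
  using assms
proof (induction I rule: finite_induct)
  case empty
  have "{x \<in> {0..<1}. 1 dvd x\<^sup>2 - 3 * x + 1} = {0 :: int}" by auto
  then show ?case by simp
next
  case (insert i I)
  \<comment> \<open>Injectivity of \<open>p\<close> makes the new prime differ from all earlier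
    ones.\<close>
  have "coprime (p i) (\<Prod>j\<in>I. p j)"
  proof (rule prod_coprime_right)
    fix j assume "j \<in> I"
    then have "p i \<noteq> p j" using insert.hyps insert.prems(1) by (auto simp: inj_on_def)
    then show "coprime (p i) (p j)" using insert.prems(2) \<open>j \<in> I\<close> by (simp add: primes_coprime)
  qed
  then have cop: "coprime (int (p i)) (int (\<Prod>j\<in>I. p j))" by (simp only: coprime_int_iff)
  have pos: "p j > 0" if "j \<in> insert i I" for j
    using insert.prems(2)[OF that] by (rule prime_gt_0_nat)
  have "card {x \<in> {0..<int (p i) * int (\<Prod>j\<in>I. p j)}. int (p i) * int (\<Prod>j\<in>I. p j) dvd x\<^sup>2 - 3 * x + 1}
    = card {x \<in> {0..<int (p i)}. int (p i) dvd x\<^sup>2 - 3 * x + 1}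
      * card {x \<in> {0..<int (\<Prod>j\<in>I. p j)}. int (\<Prod>j\<in>I. p j) dvd x\<^sup>2 - 3 * x + 1}"
  proof (rule card_roots_mod_mult[OF _ _ cop])
    show "0 < int (p i)" using pos by simp
    show "0 < int (\<Prod>j\<in>I. p j)" using pos by (simp add: prod_pos del: of_nat_prod)
  qed (intro cong_add cong_diff cong_mult cong_pow cong_refl; assumption)
  also have "card {x \<in> {0..<int (p i)}. int (p i) dvd x\<^sup>2 - 3 * x + 1} = 2"
    using insert.prems(2,3) by (intro card_roots_mod_prime) blast+
  also have "card {x \<in> {0..<int (\<Prod>j\<in>I. p j)}. int (\<Prod>j\<in>I. p j) dvd x\<^sup>2 - 3 * x + 1} = 2 ^ card I"
    using insert.prems by (intro insert.IH) auto
  finally show ?case using insert.hyps by (simp add: of_nat_prod)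
qed

theorem corollary1:
  fixes r :: nat and p :: "nat \<Rightarrow> nat" and b :: nat
  assumes "r \<ge> 1"
    and "\<And>i. i \<in> {1..r} \<Longrightarrow> prime (p i)"
    and "inj_on p {1..r}"
    and "\<And>i. i \<in> {1..r} \<Longrightarrow> [int (p i) = 1] (mod 5) \<or> [int (p i) = - 1] (mod 5)"
    and "b = (\<Prod>i = 1..r. p i)"
  shows "card {c :: int. 1 \<le> c \<and> c \<le> int b - 1 \<and> gcd c (int b) = 1
                 \<and> normalized_dedekind_sum c b = 3 / real b - 3} = 2 ^ r"
proof -
  have "b > 0" using assms(2,5) by (auto intro!: prod_pos prime_gt_0_nat)
  \<comment> \<open>For \<open>b = 1\<close> the residue 0 would be a root while the range of
    \<open>c\<close> is empty. For \<open>b > 1\<close> the value 1 at 0 rules that residue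
    out.\<close>
  moreover have "b \<noteq> 1"
  proof
    assume "b = 1"
    then have "p 1 dvd 1" using assms(1,5) by (metis atLeastAtMost_iff dvd_prodI finite_atLeastAtMost order_refl)
    then show False using assms(1) assms(2)[of 1] by auto
  qed
  ultimately have b: "b > 1" by simp
  have "{c :: int. 1 \<le> c \<and> c \<le> int b - 1 \<and> gcd c (int b) = 1
                 \<and> normalized_dedekind_sum c b = 3 / real b - 3}
      = {x \<in> {0..<int b}. int b dvd x\<^sup>2 - 3 * x + 1}" (is "?A = ?B")
  proof
    show "?A \<subseteq> ?B"
      using b by (auto simp: normalized_dedekind_sum_eq_iff_root coprime_iff_gcd_eq_1)
    show "?B \<subseteq> ?A"
    proof
      fix x assume x: "x \<in> ?B"
      then have "x \<noteq> 0" using b by (auto simp: zdvd1_eq)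
      then show "x \<in> ?A"
        using x b coprime_root[of "int b" x]
        by (auto simp: normalized_dedekind_sum_eq_iff_root coprime_iff_gcd_eq_1)
    qed
  qed
  then show ?thesis
    using card_roots_mod_prod_primes[of "{1..r}" p] assms by simp
qed

end
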